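(* Suppose $f:(X,d_X)\to(Y,d_Y)$ is a $(K,L)$-quasi-isometry between metric spaces, and let $r\ge1$. If $(X,d_X)$ admits a coarse $r$-median structure, then $(Y,d_Y)$ also admits a coarse $r$-median structure.
   Context: For $K\ge1$, $L\ge0$, a map $f:X\to Y$ is a $(K,L)$-quasi-isometry if $\frac1Kd_X(x_1,x_2)-L\le d_Y(f(x_1),f(x_2))\le Kd_X(x_1,x_2)+L$ for all $x_1,x_2\in X$ and $Y\subset\mathcal{N}_L(f(X))$. Let $(X,d)$ be a metric space and $r\ge1$. $\mathcal{N}_s(A)=\{x: d(x,A)<s\}$ for $s>0$, $\mathcal{N}_0(A)=A$; $d^{\rm H}$ is Hausdorff distance; $\mathrm{diam}(\emptyset)=0$; $\mathcal{P}(X)$ is the power set. A coarse $r$-filling on $X$ is a pair $(F,\Lambda)$ with $F=\{F_i:X^{i+1}\to\mathcal{P}(X)\}_{i=0,\dots,r}$ and $\Lambda:[0,\infty)\to[0,\infty)$ non-decreasing such that for all $k\in\{0,\dots,r\}$ and $a_0,\dots,a_k\in X$: (F0) $d^{\rm H}(a_0,F_0(a_0))\le\Lambda(0)$; (F1) (for $k\ge1$) $F_{k-1}(a_0,\dots,\widehat{a_i},\dots,a_k)\subseteq\mathcal{N}_{\Lambda(0)}(F_k(a_0,\dots,a_k))$ for all $i$; (F2) $d^{\rm H}(F_k(a_0,\dots,a_k),F_k(a_{\sigma(0)},\dots,a_{\sigma(k)}))\le\Lambda(0)$ for every permutation $\sigma$; (F3) for $k\le r-1$, $F_{k+1}(a_0,\dots,a_k,a_k)\subseteq\mathcal{N}_{\Lambda(0)}(F_k(a_0,\dots,a_k))$;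 (F4) for $R\ge0$, if $x\in\mathcal{N}_R(F_k(a_0,\dots,a_k))$ then $F_k(a_0,\dots,a_{j-1},x,a_{j+1},\dots,a_k)\subseteq\mathcal{N}_{\Lambda(R)}(F_k(a_0,\dots,a_k))$ for all $j$. For $I=\{j_1<\dots<j_p\}$ write $F_{|I|-1}(a_i:i\in I)=F_{p-1}(a_{j_1},\dots,a_{j_p})$. For $\delta,D\ge0$, $(a_0,\dots,a_{r+1})\in X^{r+2}$ is $(\delta,D)$-generic if for any non-empty proper subsets $I_1,\dots,I_q\subset\{0,\dots,r+1\}$ with $\bigcap_jI_j=\emptyset$ and $\mathrm{diam}\big(\bigcap_{j}\mathcal{N}_\delta(F_{|I_j|-1}(a_i:i\in I_j))\big)>D$ one has $|I_1|=\dots=|I_q|=r+1$. $(X,d)$ has (admits) a coarse $r$-median structure if there exist a coarse $r$-filling $(F,\Lambda)$, a constant $\delta_0\ge0$, a non-constant affine $\lambda:[\delta_0,\infty)\to[0,\infty)$ (i.e. $\lambda(\delta)=a(\delta-\delta_0)+b$, $a>0$, $b\ge0$), and $\Psi:[\delta_0,\infty)^2\to[0,\infty)$ non-decreasing in both entries such that: (CM1) for all $a_0,\dots,a_{r+1}\in X$, $\bigcap_{j=0}^{r+1}\mathcal{N}_{\lambda(\delta_0)}(F_r(a_0,\dots,\widehat{a_j},\dots,a_{r+1}))\ne\emptyset$; (CM2) for all $\delta,D\ge\delta_0$ and every $(\delta,D)$-generic $(a_0,\dots,a_{r+1})$, $\mathrm{diam}\big(\bigcap_{j=0}^{r+1}\mathcal{N}_{\lambda(\delta)}(F_r(a_0,\dots,\widehat{a_j},\dots,a_{r+1}))\big)\le\Psi(\delta,D)$.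 *)

theory Defs
  imports "HOL-Analysis.Analysis" "HOL-Combinatorics.Permutations"
begin

text \<open>
  Distances to sets, Hausdorff distances and diameters may be infinite, so they are
  valued in \<^typ>\<open>ennreal\<close>. In particular the distance to the empty set is \<^term>\<open>\<infinity> :: ennreal\<close>,
  and the diameter of the empty set is \<^term>\<open>0 :: ennreal\<close> (a supremum over the empty set).

  A tuple \<open>(a\<^sub>0, \<dots>, a\<^sub>k)\<close> is a list of length \<open>k + 1\<close>, and a family
  \<open>F\<^sub>i : X\<^sup>i\<^sup>+\<^sup>1 \<rightarrow> P(X)\<close> (\<open>0 \<le> i \<le> r\<close>) is one function on lists, \<open>F\<^sub>i\<close> being its restriction to lists
  of length \<open>i + 1\<close>. For \<open>I = {j\<^sub>1 < \<dots> < j\<^sub>p}\<close>, \<open>nths xs I\<close> is the tuple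
  \<open>(a\<^bsub>j\<^sub>1\<^esub>, \<dots>, a\<^bsub>j\<^sub>p\<^esub>)\<close>; thus \<open>nths xs (- {j})\<close> omits the entry with index \<open>j\<close>.
\<close>

context Metric_space
begin

definition dist_to_set :: "'a \<Rightarrow> 'a set \<Rightarrow> ennreal" where
  "dist_to_set x A = (INF a\<in>A. ennreal (d x a))"

definition nhood :: "real \<Rightarrow> 'a set \<Rightarrow> 'a set" where
  "nhood s A = (if s = 0 then A else {x \<in> M. dist_to_set x A < ennreal s})"

definition hausdorff_dist :: "'a set \<Rightarrow> 'a set \<Rightarrow> ennreal" where
  "hausdorff_dist A B = max (SUP a\<in>A. dist_to_set a B) (SUP b\<in>B. dist_to_set b A)"

definition diam :: "'a set \<Rightarrow> ennreal" where
  "diam A = (SUP (x, y)\<in>A \<times> A. ennreal (d x y))"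

definition tuples :: "nat \<Rightarrow> 'a list set" where
  "tuples n = {xs. length xs = n \<and> set xs \<subseteq> M}"

definition coarse_filling :: "nat \<Rightarrow> ('a list \<Rightarrow> 'a set) \<Rightarrow> (real \<Rightarrow> real) \<Rightarrow> bool" where
  "coarse_filling r F \<Lambda> \<longleftrightarrow>
     (\<forall>k\<le>r. \<forall>xs\<in>tuples (k + 1). F xs \<subseteq> M) \<and>
     mono_on {0..} \<Lambda> \<and> (\<forall>t\<ge>0. 0 \<le> \<Lambda> t) \<and>
     (\<forall>a\<in>M. hausdorff_dist {a} (F [a]) \<le> ennreal (\<Lambda> 0)) \<and>
     (\<forall>k\<in>{1..r}. \<forall>xs\<in>tuples (k + 1). \<forall>i\<le>k. F (nths xs (- {i})) \<subseteq> nhood (\<Lambda> 0) (F xs)) \<and>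
     (\<forall>k\<le>r. \<forall>xs\<in>tuples (k + 1). \<forall>\<sigma>. \<sigma> permutes {..k} \<longrightarrow>
        hausdorff_dist (F xs) (F (permute_list \<sigma> xs)) \<le> ennreal (\<Lambda> 0)) \<and>
     (\<forall>k. k + 1 \<le> r \<longrightarrow> (\<forall>xs\<in>tuples (k + 1). F (xs @ [last xs]) \<subseteq> nhood (\<Lambda> 0) (F xs))) \<and>
     (\<forall>k\<le>r. \<forall>xs\<in>tuples (k + 1). \<forall>R\<ge>0. \<forall>x\<in>nhood R (F xs). \<forall>j\<le>k.
        F (xs[j := x]) \<subseteq> nhood (\<Lambda> R) (F xs))"

definition generic :: "nat \<Rightarrow> ('a list \<Rightarrow> 'a set) \<Rightarrow> real \<Rightarrow> real \<Rightarrow> 'a list \<Rightarrow> bool" where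
  "generic r F \<delta> D xs \<longleftrightarrow>
     (\<forall>q\<ge>1. \<forall>I :: nat \<Rightarrow> nat set.
        (\<forall>j\<in>{1..q}. I j \<noteq> {} \<and> I j \<subset> {0..r + 1}) \<and>
        (\<Inter>j\<in>{1..q}. I j) = {} \<and>
        diam (\<Inter>j\<in>{1..q}. nhood \<delta> (F (nths xs (I j)))) > ennreal D
        \<longrightarrow> (\<forall>j\<in>{1..q}. card (I j) = r + 1))"

text \<open>\<open>\<mu>\<close> is the affine function usually called \<open>\<lambda>\<close> (a reserved symbol here).\<close>

definition has_coarse_median_structure :: "nat \<Rightarrow> bool" where
  "has_coarse_median_structure r \<longleftrightarrow>
     (\<exists>F \<Lambda> \<delta>\<^sub>0 a b \<mu> \<Psi>.
        coarse_filling r F \<Lambda> \<and> \<delta>\<^sub>0 \<ge> 0 \<and>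
        a > 0 \<and> b \<ge> 0 \<and> (\<forall>\<delta>\<ge>\<delta>\<^sub>0. \<mu> \<delta> = a * (\<delta> - \<delta>\<^sub>0) + b) \<and>
        (\<forall>\<delta>\<ge>\<delta>\<^sub>0. \<forall>D\<ge>\<delta>\<^sub>0. (0::real) \<le> \<Psi> \<delta> D) \<and>
        (\<forall>\<delta>\<ge>\<delta>\<^sub>0. mono_on {\<delta>\<^sub>0..} (\<lambda>D. \<Psi> \<delta> D)) \<and>
        (\<forall>D\<ge>\<delta>\<^sub>0. mono_on {\<delta>\<^sub>0..} (\<lambda>\<delta>. \<Psi> \<delta> D)) \<and>
        (\<forall>xs\<in>tuples (r + 2).
           (\<Inter>j\<in>{0..r + 1}. nhood (\<mu> \<delta>\<^sub>0) (F (nths xs (- {j})))) \<noteq> {}) \<and>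
        (\<forall>\<delta>\<ge>\<delta>\<^sub>0. \<forall>D\<ge>\<delta>\<^sub>0. \<forall>xs\<in>tuples (r + 2). generic r F \<delta> D xs \<longrightarrow>
           diam (\<Inter>j\<in>{0..r + 1}. nhood (\<mu> \<delta>) (F (nths xs (- {j})))) \<le> ennreal (\<Psi> \<delta> D)))"

end

definition quasi_isometry ::
  "real \<Rightarrow> real \<Rightarrow> 'a set \<Rightarrow> ('a \<Rightarrow> 'a \<Rightarrow> real) \<Rightarrow> 'b set \<Rightarrow> ('b \<Rightarrow> 'b \<Rightarrow> real) \<Rightarrow> ('a \<Rightarrow> 'b) \<Rightarrow> bool"
where
  "quasi_isometry K L X dX Y dY f \<longleftrightarrow>
     K \<ge> 1 \<and> L \<ge> 0 \<and> f \<in> X \<rightarrow> Y \<and>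
     (\<forall>x\<^sub>1\<in>X. \<forall>x\<^sub>2\<in>X. 1 / K * dX x\<^sub>1 x\<^sub>2 - L \<le> dY (f x\<^sub>1) (f x\<^sub>2) \<and>
                      dY (f x\<^sub>1) (f x\<^sub>2) \<le> K * dX x\<^sub>1 x\<^sub>2 + L) \<and>
     Y \<subseteq> Metric_space.nhood Y dY L (f ` X)"

end

theory Submission
  imports Defs
begin

text \<open>
  Let \<open>g\<close> be a coarse inverse of \<open>f\<close>, and transport the filling by \<open>F' ys = f ` F (map g ys)\<close>.
  Neighbourhoods of \<open>F (map g ys)\<close> and of \<open>F' ys\<close> correspond to each other under \<open>f\<close> and \<open>g\<close>, up to
  affine changes of the radius, so (F0)--(F4) and (CM1) carry over. For (CM2), a
  \<open>(\<delta>, D)\<close>-generic tuple in \<open>Y\<close> has a \<open>(\<delta>\<^sub>1, K * (D + L))\<close>-generic image under \<open>g\<close> as soon as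
  \<open>K * \<delta>\<^sub>1 + L < \<delta>\<close>, and the slope of the affine function is divided by \<open>K\<^sup>2\<close>: one factor \<open>K\<close> is
  lost in passing from \<open>\<delta>\<close> to \<open>\<delta>\<^sub>1\<close>, the other in pulling back the neighbourhoods along \<open>g\<close>.
\<close>

section \<open>Neighbourhoods, Hausdorff distance and diameter as real inequalities\<close>

context Metric_space
begin

lemma nhoodI:
  assumes "x \<in> M" "a \<in> A" "d x a < s"
  shows "x \<in> nhood s A"
proof -
  have "s > 0" using assms(3) nonneg[of x a] by linarith
  moreover have "dist_to_set x A < ennreal s"
    unfolding dist_to_set_def INF_less_iff
    using assms by (auto intro!: bexI[of _ a] simp: ennreal_less_iff)
  ultimately show ?thesis using assms(1) by (simp add: nhood_def)
qed

text \<open>Only the weak inequality also covers \<open>s = 0\<close>, where the neighbourhood is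
  \<open>A\<close> and \<open>x\<close> is its own witness. As \<open>nhoodI\<close> asks for a
  strict one, each later passage between neighbourhoods needs a strict margin.\<close>

lemma nhoodE:
  assumes "x \<in> nhood s A" "A \<subseteq> M" "0 \<le> s"
  obtains a where "x \<in> M" "a \<in> A" "d x a \<le> s"
proof (cases "s = 0")
  case True
  then show ?thesis using assms that[of x] by (auto simp: nhood_def)
next
  case False
  then have "x \<in> M" "dist_to_set x A < ennreal s" using assms(1) by (auto simp: nhood_def)
  then obtain a where "a \<in> A" "ennreal (d x a) < ennreal s"
    unfolding dist_to_set_def INF_less_iff by blast
  then show ?thesis using that[of a] \<open>x \<in> M\<close> by (auto simp: ennreal_less_iff)
qed

lemma dist_to_set_leI:
  assumes "a \<in> A" "d x a \<le> c"
  shows "dist_to_set x A \<le> ennreal c"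
  unfolding dist_to_set_def using assms by (auto intro!: INF_lower2 ennreal_leI)

text \<open>The infimum need not be attained, so a witness costs some slack, here 1. Since
  \<open>ennreal\<close> truncates negative reals to 0, \<open>0 \<le> c\<close> is what makes
  \<open>ennreal c < ennreal (c + 1)\<close>.\<close>

lemma dist_to_set_leE:
  assumes "dist_to_set x A \<le> ennreal c" "0 \<le> c"
  obtains a where "a \<in> A" "d x a < c + 1"
proof -
  have "ennreal c < ennreal (c + 1)" using assms(2) by (simp add: ennreal_less_iff)
  with assms(1) have "dist_to_set x A < ennreal (c + 1)" by (rule le_less_trans)
  then obtain a where "a \<in> A" "ennreal (d x a) < ennreal (c + 1)"
    unfolding dist_to_set_def INF_less_iff by blast
  then show ?thesis using that[of a] by (auto simp: ennreal_less_iff)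
qed

lemma hausdorff_dist_le_iff:
  "hausdorff_dist A B \<le> c \<longleftrightarrow>
    (\<forall>a\<in>A. dist_to_set a B \<le> c) \<and> (\<forall>b\<in>B. dist_to_set b A \<le> c)"
  by (simp add: hausdorff_dist_def SUP_le_iff)

lemma diam_le_iff:
  assumes "0 \<le> c"
  shows "diam A \<le> ennreal c \<longleftrightarrow> (\<forall>x\<in>A. \<forall>y\<in>A. d x y \<le> c)"
  using assms by (simp add: diam_def SUP_le_iff ennreal_le_iff)

lemma less_diam_iff:
  assumes "0 \<le> c"
  shows "ennreal c < diam A \<longleftrightarrow> (\<exists>x\<in>A. \<exists>y\<in>A. c < d x y)"
  using diam_le_iff[OF assms, of A] by (force simp: not_le[symmetric])

lemma coarse_filling_subset:
  assumes "coarse_filling r F \<Lambda>" "xs \<noteq> []" "length xs \<le> r + 1" "set xs \<subseteq> M"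
  shows "F xs \<subseteq> M"
proof -
  obtain k where "length xs = k + 1" using assms(2) by (cases xs) auto
  then have "k \<le> r" "xs \<in> tuples (k + 1)" using assms by (auto simp: tuples_def)
  then show ?thesis using assms(1) by (auto simp: coarse_filling_def)
qed

lemma coarse_filling_subset_nths:
  assumes "coarse_filling r F \<Lambda>" "xs \<in> tuples (r + 2)"
    "I \<inter> {0..r + 1} \<noteq> {}" "\<not> {0..r + 1} \<subseteq> I"
  shows "F (nths xs I) \<subseteq> M"
proof (rule coarse_filling_subset[OF assms(1)])
  have len: "length xs = r + 2" and "set xs \<subseteq> M" using assms(2) by (auto simp: tuples_def)
  then show "set (nths xs I) \<subseteq> M" using set_nths_subset[of xs I] by blast
  let ?S = "{i. i < length xs \<and> i \<in> I}"
  have S: "?S = I \<inter> {0..r + 1}" using len by auto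
  have "card ?S < card {0..r + 1}" using assms(4) unfolding S by (intro psubset_card_mono) auto
  then show "length (nths xs I) \<le> r + 1" by (simp add: length_nths)
  have "card ?S > 0" using assms(3) unfolding S by (subst card_gt_0_iff) auto
  then show "nths xs I \<noteq> []" by (auto simp: length_nths[symmetric])
qed

end

section \<open>Metric estimates along a map with a coarse inverse\<close>

locale coarse_inverse_pair = X: Metric_space X dX + Y: Metric_space Y dY
  for X :: "'a set" and dX and Y :: "'b set" and dY +
  fixes f :: "'a \<Rightarrow> 'b" and g :: "'b \<Rightarrow> 'a" and K L :: real
  assumes K: "1 \<le> K" and L: "0 \<le> L"
    and f: "x \<in> X \<Longrightarrow> f x \<in> Y" and g: "y \<in> Y \<Longrightarrow> g y \<in> X"
    and upper: "x \<in> X \<Longrightarrow> x' \<in> X \<Longrightarrow> dY (f x) (f x') \<le> K * dX x x' + L"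
    and lower: "x \<in> X \<Longrightarrow> x' \<in> X \<Longrightarrow> dX x x' \<le> K * (dY (f x) (f x') + L)"
    \<comment> \<open>The only metric condition on \<open>g\<close>; estimates for \<open>g\<close>
      come from comparing \<open>f (g y)\<close> with \<open>y\<close>.\<close>
    and fg: "y \<in> Y \<Longrightarrow> dY y (f (g y)) \<le> L"
begin

lemma upper_le:
  assumes "x \<in> X" "x' \<in> X" "dX x x' \<le> c"
  shows "dY (f x) (f x') \<le> K * c + L"
  using upper[OF assms(1,2)] mult_left_mono[OF assms(3), of K] K by linarith

text \<open>The detour through \<open>f (g y)\<close> and \<open>f (g y')\<close> costs
  \<open>L\<close> at each end, and \<open>upper\<close> costs the third \<open>L\<close>.\<close>

lemma g_lower_le:
  assumes "y \<in> Y" "y' \<in> Y" "dX (g y) (g y') \<le> c"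
  shows "dY y y' \<le> K * c + 3 * L"
proof -
  have "dY y y' \<le> dY y (f (g y)) + dY (f (g y)) (f (g y')) + dY (f (g y')) y'"
    using Y.triangle[of y "f (g y)" y'] Y.triangle[of "f (g y)" "f (g y')" y'] assms f g
    by fastforce
  then show ?thesis
    using fg[OF assms(1)] fg[OF assms(2)] Y.commute[of y' "f (g y')"]
      upper_le[OF g[OF assms(1)] g[OF assms(2)] assms(3)] by linarith
qed

lemma nhood_image:
  assumes "x \<in> X.nhood s A" "A \<subseteq> X" "0 \<le> s" "K * s + L < t"
  shows "f x \<in> Y.nhood t (f ` A)"
proof -
  obtain a where a: "x \<in> X" "a \<in> A" "dX x a \<le> s" using X.nhoodE[OF assms(1-3)] .
  then have "dY (f x) (f a) \<le> K * s + L" using assms(2) by (intro upper_le) auto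
  then show ?thesis using a assms(4) f by (intro Y.nhoodI) auto
qed

text \<open>If \<open>f a\<close> is within \<open>s\<close> of \<open>y\<close>, it is within
  \<open>s + L\<close> of \<open>f (g y)\<close>; \<open>lower\<close> then adds another
  \<open>L\<close> and the factor \<open>K\<close>. Comparing \<open>g y\<close> with
  \<open>a\<close> itself avoids any estimate of \<open>g (f a)\<close>.\<close>

lemma nhood_preimage:
  assumes "y \<in> Y.nhood s (f ` A)" "A \<subseteq> X" "0 \<le> s" "K * (s + 2 * L) < t"
  shows "g y \<in> X.nhood t A"
proof -
  have "f ` A \<subseteq> Y" using assms(2) f by auto
  then obtain a where a: "y \<in> Y" "a \<in> A" "dY y (f a) \<le> s"
    using Y.nhoodE[OF assms(1) _ assms(3)] by blast
  have aX: "a \<in> X" using a assms(2) by auto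
  have "dY (f (g y)) (f a) \<le> dY (f (g y)) y + dY y (f a)"
    using a aX f g by (intro Y.triangle) auto
  also have "\<dots> \<le> s + L" using a fg[of y] by (simp add: Y.commute)
  finally have "K * (dY (f (g y)) (f a) + L) \<le> K * (s + 2 * L)"
    using K by (intro mult_left_mono) auto
  then have "dX (g y) a < t" using lower[OF g[OF a(1)] aX] assms(4) by linarith
  then show ?thesis using a g by (intro X.nhoodI) auto
qed

lemma map_g_tuples: "ys \<in> Y.tuples n \<Longrightarrow> map g ys \<in> X.tuples n"
  using g by (auto simp: X.tuples_def Y.tuples_def)

lemma hausdorff_dist_image_le:
  assumes "X.hausdorff_dist A B \<le> ennreal c" "A \<subseteq> X" "B \<subseteq> X" "0 \<le> c" "K * (c + 1) + L \<le> t"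
  shows "Y.hausdorff_dist (f ` A) (f ` B) \<le> ennreal t"
proof -
  have *: "Y.dist_to_set (f a) (f ` B) \<le> ennreal t"
    if near: "X.dist_to_set a B \<le> ennreal c" and "a \<in> X" "B \<subseteq> X" for a B
  proof -
    obtain b where b: "b \<in> B" "dX a b < c + 1" using X.dist_to_set_leE[OF near assms(4)] .
    then have "dY (f a) (f b) \<le> K * (c + 1) + L" using that by (intro upper_le) auto
    then show ?thesis using b assms(5) by (intro Y.dist_to_set_leI[of "f b"]) auto
  qed
  show ?thesis using assms unfolding X.hausdorff_dist_le_iff Y.hausdorff_dist_le_iff
    by (auto intro!: *)
qed

section \<open>Transport of the filling and of genericity\<close>

definition push :: "('a list \<Rightarrow> 'a set) \<Rightarrow> 'b list \<Rightarrow> 'b set" where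
  "push F ys = f ` F (map g ys)"

text \<open>One bound for all of (F0)--(F4): the argument of \<open>\<Lambda>\<close> is the radius
  from \<open>nhood_preimage\<close> with strict margin 1, the inner \<open>+ 1\<close> pays for
  unattained infima, one \<open>L\<close> is the error of \<open>f\<close>, the other that of
  \<open>fg\<close> in (F0), and the last 1 gives strictness.\<close>

definition push_bound :: "(real \<Rightarrow> real) \<Rightarrow> real \<Rightarrow> real" where
  "push_bound \<Lambda> R = K * (\<Lambda> (K * (R + 2 * L) + 1) + 1) + 2 * L + 1"

lemma coarse_filling_push:
  assumes fill: "X.coarse_filling r F \<Lambda>"
  shows "Y.coarse_filling r (push F) (push_bound \<Lambda>)"
proof -
  have mono: "mono_on {0..} \<Lambda>" and pos: "\<And>t. 0 \<le> t \<Longrightarrow> 0 \<le> \<Lambda> t"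
    and sub: "\<And>k xs. xs \<in> X.tuples (k + 1) \<Longrightarrow> k \<le> r \<Longrightarrow> F xs \<subseteq> X"
    and F0: "\<And>a. a \<in> X \<Longrightarrow> X.hausdorff_dist {a} (F [a]) \<le> ennreal (\<Lambda> 0)"
    and F1: "\<And>k xs i. k \<in> {1..r} \<Longrightarrow> xs \<in> X.tuples (k + 1) \<Longrightarrow> i \<le> k \<Longrightarrow>
      F (nths xs (- {i})) \<subseteq> X.nhood (\<Lambda> 0) (F xs)"
    and F2: "\<And>k xs \<sigma>. k \<le> r \<Longrightarrow> xs \<in> X.tuples (k + 1) \<Longrightarrow> \<sigma> permutes {..k} \<Longrightarrow>
      X.hausdorff_dist (F xs) (F (permute_list \<sigma> xs)) \<le> ennreal (\<Lambda> 0)"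
    and F3: "\<And>k xs. k + 1 \<le> r \<Longrightarrow> xs \<in> X.tuples (k + 1) \<Longrightarrow>
      F (xs @ [last xs]) \<subseteq> X.nhood (\<Lambda> 0) (F xs)"
    and F4: "\<And>k xs R x j. k \<le> r \<Longrightarrow> xs \<in> X.tuples (k + 1) \<Longrightarrow> 0 \<le> R \<Longrightarrow>
      x \<in> X.nhood R (F xs) \<Longrightarrow> j \<le> k \<Longrightarrow> F (xs[j := x]) \<subseteq> X.nhood (\<Lambda> R) (F xs)"
    using fill unfolding X.coarse_filling_def by simp_all
  have arg: "0 \<le> K * (R + 2 * L) + 1" if "0 \<le> R" for R using K L that by simp
  have le: "K * (s + 1) + L < push_bound \<Lambda> R" "K * s + L < push_bound \<Lambda> R"
    if "s \<le> \<Lambda> (K * (R + 2 * L) + 1)" for s R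
  proof -
    have "K * (s + 1) \<le> K * (\<Lambda> (K * (R + 2 * L) + 1) + 1)"
      using K that by (intro mult_left_mono) auto
    then show "K * (s + 1) + L < push_bound \<Lambda> R" using L by (simp add: push_bound_def)
    moreover have "K * s \<le> K * (s + 1)" using K by (intro mult_left_mono) auto
    ultimately show "K * s + L < push_bound \<Lambda> R" by linarith
  qed
  \<comment> \<open>Even at \<open>R = 0\<close>, \<open>push_bound\<close> evaluates
    \<open>\<Lambda>\<close> at a positive argument; monotonicity relates this to the constant
    \<open>\<Lambda> 0\<close> of (F0)--(F3).\<close>
  have "\<Lambda> 0 \<le> \<Lambda> (K * (0 + 2 * L) + 1)" using arg[of 0] by (intro mono_onD[OF mono]) auto
  note le0 = le[OF this]
  have \<Lambda>0: "0 \<le> \<Lambda> 0" by (simp add: pos)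
  have img: "f ` A \<subseteq> Y.nhood t (f ` B)"
    if "A \<subseteq> X.nhood s B" "B \<subseteq> X" "0 \<le> s" "K * s + L < t" for A B s t
    using that nhood_image by blast
  show ?thesis
    unfolding Y.coarse_filling_def
  proof (intro conjI allI ballI impI)
    fix k ys assume "k \<le> r" "ys \<in> Y.tuples (k + 1)"
    then show "push F ys \<subseteq> Y" using sub[OF map_g_tuples] f by (force simp: push_def)
  next
    show "mono_on {0..} (push_bound \<Lambda>)"
    proof (rule mono_onI)
      fix R R' :: real assume R: "R \<in> {0..}" "R' \<in> {0..}" "R \<le> R'"
      have "K * (R + 2 * L) \<le> K * (R' + 2 * L)" using R K by (intro mult_left_mono) auto
      then have "\<Lambda> (K * (R + 2 * L) + 1) \<le> \<Lambda> (K * (R' + 2 * L) + 1)"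
        using R arg by (intro mono_onD[OF mono]) auto
      then show "push_bound \<Lambda> R \<le> push_bound \<Lambda> R'" using K by (simp add: push_bound_def)
    qed
  next
    fix R :: real assume "0 \<le> R"
    then show "0 \<le> push_bound \<Lambda> R" using pos[OF arg] K L by (simp add: push_bound_def)
  next
    fix y assume y: "y \<in> Y"
    have H: "X.hausdorff_dist {g y} (F [g y]) \<le> ennreal (\<Lambda> 0)" by (rule F0[OF g[OF y]])
    have S: "F [g y] \<subseteq> X" using sub[of "[g y]" 0] g[OF y] by (auto simp: X.tuples_def)
    \<comment> \<open>A finite Hausdorff distance forces \<open>F [g y]\<close> to be non-empty, the
      distance to the empty set being infinite.\<close>
    obtain x\<^sub>0 where x0: "x\<^sub>0 \<in> F [g y]"
      using H X.dist_to_set_leE[OF _ \<Lambda>0] unfolding X.hausdorff_dist_le_iff by blast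
    \<comment> \<open>\<open>hausdorff_dist_image_le\<close> would compare with
      \<open>{f (g y)}\<close> instead of \<open>{y}\<close>; the direct estimate pays the extra
      \<open>L\<close>.\<close>
    have near: "dY y (f x) \<le> push_bound \<Lambda> 0" if "x \<in> F [g y]" for x
    proof -
      have x: "x \<in> X" using that S by auto
      have "X.dist_to_set x {g y} \<le> ennreal (\<Lambda> 0)"
        using H that unfolding X.hausdorff_dist_le_iff by blast
      then have "dX (g y) x < \<Lambda> 0 + 1" using X.dist_to_set_leE[OF _ \<Lambda>0] by (metis X.commute singletonD)
      then have 1: "dY (f (g y)) (f x) \<le> K * (\<Lambda> 0 + 1) + L" using x g y by (intro upper_le) auto
      have "dY y (f x) \<le> dY y (f (g y)) + dY (f (g y)) (f x)"
        using x y f g by (intro Y.triangle) auto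
      moreover have "K * (\<Lambda> 0 + 1) \<le> K * (\<Lambda> (K * (0 + 2 * L) + 1) + 1)"
        using K \<open>\<Lambda> 0 \<le> \<Lambda> (K * (0 + 2 * L) + 1)\<close> by (intro mult_left_mono) auto
      ultimately show ?thesis using 1 fg[OF y] unfolding push_bound_def by linarith
    qed
    show "Y.hausdorff_dist {y} (push F [y]) \<le> ennreal (push_bound \<Lambda> 0)"
      unfolding Y.hausdorff_dist_le_iff push_def
      using near x0
      by (auto intro: Y.dist_to_set_leI[of "f x\<^sub>0"] Y.dist_to_set_leI[of y] simp: Y.commute)
  next
    fix k ys i assume k: "k \<in> {1..r}" and ys: "ys \<in> Y.tuples (k + 1)" and i: "i \<le> k"
    have "F (nths (map g ys) (- {i})) \<subseteq> X.nhood (\<Lambda> 0) (F (map g ys))"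
      by (rule F1[OF k map_g_tuples[OF ys] i])
    then show "push F (nths ys (- {i})) \<subseteq> Y.nhood (push_bound \<Lambda> 0) (push F ys)"
      unfolding push_def nths_map
      using k sub[OF map_g_tuples[OF ys]] \<Lambda>0 le0(2) by (intro img) auto
  next
    fix k ys \<sigma> assume k: "k \<le> r" and ys: "ys \<in> Y.tuples (k + 1)" and \<sigma>: "\<sigma> permutes {..k}"
    have len: "\<sigma> permutes {..<length ys}"
      using \<sigma> ys by (simp add: Y.tuples_def lessThan_Suc_atMost)
    have p: "map g (permute_list \<sigma> ys) = permute_list \<sigma> (map g ys)"
      by (rule permute_list_map[OF len, symmetric])
    have "permute_list \<sigma> ys \<in> Y.tuples (k + 1)" using ys len by (simp add: Y.tuples_def)
    note this[THEN map_g_tuples, unfolded p]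
    moreover have "X.hausdorff_dist (F (map g ys)) (F (permute_list \<sigma> (map g ys))) \<le> ennreal (\<Lambda> 0)"
      by (rule F2[OF k map_g_tuples[OF ys] \<sigma>])
    ultimately show "Y.hausdorff_dist (push F ys) (push F (permute_list \<sigma> ys)) \<le> ennreal (push_bound \<Lambda> 0)"
      unfolding push_def p
      using k sub map_g_tuples[OF ys] \<Lambda>0 le0(1) by (intro hausdorff_dist_image_le[of _ _ "\<Lambda> 0"]) auto
  next
    fix k ys assume k: "k + 1 \<le> r" and ys: "ys \<in> Y.tuples (k + 1)"
    \<comment> \<open>\<open>last []\<close> is unspecified, so \<open>map g\<close> commutes with
      \<open>last\<close> only on non-empty lists.\<close>
    then have "ys \<noteq> []" by (auto simp: Y.tuples_def)
    then have "map g (ys @ [last ys]) = map g ys @ [last (map g ys)]" by (simp add: last_map)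
    moreover have "F (map g ys @ [last (map g ys)]) \<subseteq> X.nhood (\<Lambda> 0) (F (map g ys))"
      by (rule F3[OF k map_g_tuples[OF ys]])
    ultimately show "push F (ys @ [last ys]) \<subseteq> Y.nhood (push_bound \<Lambda> 0) (push F ys)"
      unfolding push_def
      using k sub[OF map_g_tuples[OF ys]] \<Lambda>0 le0(2) by (metis img add_leD1)
  next
    fix k ys j and R :: real and y
    assume k: "k \<le> r" and ys: "ys \<in> Y.tuples (k + 1)" and R: "0 \<le> R"
      and y: "y \<in> Y.nhood R (push F ys)" and j: "j \<le> k"
    note S = sub[OF map_g_tuples[OF ys] k]
    \<comment> \<open>(F4) in \<open>X\<close> is applied to \<open>g y\<close>, at the enlarged
      radius that \<open>push_bound\<close> anticipates.\<close>
    have "g y \<in> X.nhood (K * (R + 2 * L) + 1) (F (map g ys))"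
      using y S R unfolding push_def by (rule nhood_preimage) simp
    then have "F ((map g ys)[j := g y]) \<subseteq> X.nhood (\<Lambda> (K * (R + 2 * L) + 1)) (F (map g ys))"
      by (rule F4[OF k map_g_tuples[OF ys] arg[OF R] _ j])
    then show "push F (ys[j := y]) \<subseteq> Y.nhood (push_bound \<Lambda> R) (push F ys)"
      unfolding push_def map_update
      using S pos[OF arg[OF R]] le(2)[OF order_refl] by (intro img) auto
  qed
qed

text \<open>For the same index sets, \<open>f\<close> maps the intersection in \<open>X\<close> into
  the one in \<open>Y\<close>, and by \<open>lower\<close> points more than
  \<open>K * (D + L)\<close> apart have images more than \<open>D\<close> apart. So a family tested
  in \<open>X\<close> is also tested in \<open>Y\<close>.\<close>

lemma generic_map_g:
  assumes fill: "X.coarse_filling r F \<Lambda>" and ys: "ys \<in> Y.tuples (r + 2)"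
    and gen: "Y.generic r (push F) \<delta> D ys"
    and \<delta>': "0 \<le> \<delta>'" "K * \<delta>' + L < \<delta>" and D: "0 \<le> D"
  shows "X.generic r F \<delta>' (K * (D + L)) (map g ys)"
  unfolding X.generic_def
proof (intro allI impI)
  fix q :: nat and I :: "nat \<Rightarrow> nat set"
  let ?A = "\<Inter>j\<in>{1..q}. X.nhood \<delta>' (F (nths (map g ys) (I j)))"
  let ?B = "\<Inter>j\<in>{1..q}. Y.nhood \<delta> (push F (nths ys (I j)))"
  assume q: "1 \<le> q"
    and "(\<forall>j\<in>{1..q}. I j \<noteq> {} \<and> I j \<subset> {0..r + 1}) \<and> (\<Inter>j\<in>{1..q}. I j) = {} \<and>
      ennreal (K * (D + L)) < X.diam ?A"
  then have I: "\<And>j. j \<in> {1..q} \<Longrightarrow> I j \<noteq> {} \<and> I j \<subset> {0..r + 1}" "(\<Inter>j\<in>{1..q}. I j) = {}"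
    and dm: "ennreal (K * (D + L)) < X.diam ?A" by blast+
  have S: "F (nths (map g ys) (I j)) \<subseteq> X" if "j \<in> {1..q}" for j
    using I(1)[OF that] by (intro X.coarse_filling_subset_nths[OF fill map_g_tuples[OF ys]]) auto
  have fB: "f x \<in> ?B" if "x \<in> ?A" for x
    unfolding push_def nths_map[symmetric]
    using nhood_image[OF _ S \<delta>'] that by auto
  obtain x x' where x: "x \<in> ?A" "x' \<in> ?A" "K * (D + L) < dX x x'"
    using dm K L D by (subst (asm) X.less_diam_iff) auto
  \<comment> \<open>An intersection over no index would be \<open>UNIV\<close>; the index 1 places
    \<open>x\<close> and \<open>x'\<close> in \<open>X\<close>.\<close>
  have "1 \<in> {1..q}" using q by simp
  then have X: "x \<in> X" "x' \<in> X" using x X.nhoodE[OF _ S \<delta>'(1)] by blast+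
  have "K * (D + L) < K * (dY (f x) (f x') + L)" using lower[OF X] x(3) by linarith
  then have "D < dY (f x) (f x')" using K by simp
  then have "ennreal D < Y.diam ?B" using fB x D by (auto simp only: Y.less_diam_iff)
  then show "\<forall>j\<in>{1..q}. card (I j) = r + 1"
    using gen[unfolded Y.generic_def, rule_format, of q I] q I by blast
qed

section \<open>The coarse median structure on \<open>Y\<close>\<close>

lemma has_coarse_median_structure_push:
  assumes "X.has_coarse_median_structure r"
  shows "Y.has_coarse_median_structure r"
proof -
  obtain F \<Lambda> \<delta>\<^sub>0 a b \<mu> \<Psi> where fill: "X.coarse_filling r F \<Lambda>" and \<delta>0: "\<delta>\<^sub>0 \<ge> 0"
    and a: "a > 0" and b: "b \<ge> 0" and \<mu>: "\<forall>\<delta>\<ge>\<delta>\<^sub>0. \<mu> \<delta> = a * (\<delta> - \<delta>\<^sub>0) + b"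
    and \<Psi>0: "\<forall>\<delta>\<ge>\<delta>\<^sub>0. \<forall>D\<ge>\<delta>\<^sub>0. (0::real) \<le> \<Psi> \<delta> D"
    and \<Psi>1: "\<forall>\<delta>\<ge>\<delta>\<^sub>0. mono_on {\<delta>\<^sub>0..} (\<lambda>D. \<Psi> \<delta> D)"
    and \<Psi>2: "\<forall>D\<ge>\<delta>\<^sub>0. mono_on {\<delta>\<^sub>0..} (\<lambda>\<delta>. \<Psi> \<delta> D)"
    and CM1: "\<forall>xs\<in>X.tuples (r + 2).
           (\<Inter>j\<in>{0..r + 1}. X.nhood (\<mu> \<delta>\<^sub>0) (F (nths xs (- {j})))) \<noteq> {}"
    and CM2: "\<forall>\<delta>\<ge>\<delta>\<^sub>0. \<forall>D\<ge>\<delta>\<^sub>0. \<forall>xs\<in>X.tuples (r + 2). X.generic r F \<delta> D xs \<longrightarrow>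
           X.diam (\<Inter>j\<in>{0..r + 1}. X.nhood (\<mu> \<delta>) (F (nths xs (- {j})))) \<le> ennreal (\<Psi> \<delta> D)"
    using assms unfolding X.has_coarse_median_structure_def by (elim exE conjE) (rule that)
  \<comment> \<open>The radius for (CM1) in \<open>Y\<close>: the image under \<open>f\<close> of
    radius \<open>b\<close>, plus 1 for strictness.\<close>
  define b' where "b' = K * b + L + 1"
  \<comment> \<open>The offset \<open>t\<close> leaves room in \<open>\<mu> (\<rho> \<delta>)\<close> for the additive error of \<open>nhood_preimage\<close>.\<close>
  define t where "t = (K * (b' + 2 * L) + 1) / a"
  \<comment> \<open>\<open>\<rho>\<close> solves
    \<open>K * \<rho> \<delta> + L = \<delta> - 1\<close>, as \<open>generic_map_g\<close> requires,
    and \<open>\<delta>\<^sub>1\<close> is the point where \<open>\<rho>\<close> takes the value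
    \<open>\<delta>\<^sub>0 + t\<close>.\<close>
  define \<delta>\<^sub>1 where "\<delta>\<^sub>1 = K * (\<delta>\<^sub>0 + t) + L + 1"
  define \<rho> where "\<rho> \<delta> = (\<delta> - \<delta>\<^sub>1) / K + \<delta>\<^sub>0 + t" for \<delta>
  define \<mu>' where "\<mu>' \<delta> = a / K\<^sup>2 * (\<delta> - \<delta>\<^sub>1) + b'" for \<delta>
  \<comment> \<open>The diameter bound at the parameters from \<open>generic_map_g\<close>, carried
    to \<open>Y\<close> by \<open>g_lower_le\<close>.\<close>
  define \<Psi>' where "\<Psi>' \<delta> D = K * \<Psi> (\<rho> \<delta>) (K * (D + L)) + 3 * L" for \<delta> D
  have b': "b' \<ge> 0" using K L b by (simp add: b'_def)
  have t: "t \<ge> 0" using K L b' a by (simp add: t_def)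
  have "\<delta>\<^sub>0 \<le> K * (\<delta>\<^sub>0 + t)" using K \<delta>0 t mult_mono[of 1 K \<delta>\<^sub>0 "\<delta>\<^sub>0 + t"] by simp
  then have \<delta>01: "\<delta>\<^sub>0 \<le> \<delta>\<^sub>1" using L by (simp add: \<delta>\<^sub>1_def)
  have \<rho>_ge: "\<delta>\<^sub>0 \<le> \<rho> \<delta>" if "\<delta>\<^sub>1 \<le> \<delta>" for \<delta> using that t K by (simp add: \<rho>_def)
  have \<rho>_less: "K * \<rho> \<delta> + L < \<delta>" for \<delta>
  proof -
    have "K * \<rho> \<delta> = (\<delta> - \<delta>\<^sub>1) + K * (\<delta>\<^sub>0 + t)" using K by (simp add: \<rho>_def field_simps)
    then show ?thesis by (simp add: \<delta>\<^sub>1_def)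
  qed
  have \<rho>_mono: "\<rho> \<delta> \<le> \<rho> \<delta>'" if "\<delta> \<le> \<delta>'" for \<delta> \<delta>'
    using that K by (simp add: \<rho>_def divide_right_mono)
  have D_ge: "\<delta>\<^sub>0 \<le> K * (D + L)" if "\<delta>\<^sub>1 \<le> D" for D
    using that \<delta>01 \<delta>0 K L mult_mono[of 1 K \<delta>\<^sub>0 "D + L"] by simp
  have D_mono: "K * (D + L) \<le> K * (D' + L)" if "D \<le> D'" for D D'
    using that K by simp
  have \<mu>_ge0: "0 \<le> \<mu>' \<delta>" if "\<delta>\<^sub>1 \<le> \<delta>" for \<delta> using that a b' by (simp add: \<mu>'_def)
  have \<mu>_less: "K * (\<mu>' \<delta> + 2 * L) < \<mu> (\<rho> \<delta>)" if "\<delta>\<^sub>1 \<le> \<delta>" for \<delta>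
  proof -
    \<comment> \<open>The slope \<open>a / K\<^sup>2\<close> times \<open>K\<close> is the slope of
      \<open>a * \<rho> \<delta>\<close>, and \<open>t\<close> was chosen to match the constant
      terms, leaving exactly the margin 1.\<close>
    have "K * (\<mu>' \<delta> + 2 * L) + 1 = a / K * (\<delta> - \<delta>\<^sub>1) + a * t"
      using K a by (simp add: \<mu>'_def t_def field_simps power2_eq_square)
    also have "\<dots> = a * (\<rho> \<delta> - \<delta>\<^sub>0)" using K by (simp add: \<rho>_def field_simps)
    also have "\<dots> \<le> \<mu> (\<rho> \<delta>)" using \<mu> \<rho>_ge[OF that] b by simp
    finally show ?thesis by simp
  qed
  have S: "F (nths (map g ys) (- {j})) \<subseteq> X"
    if "ys \<in> Y.tuples (r + 2)" "j \<in> {0..r + 1}" for ys j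
  proof (rule X.coarse_filling_subset_nths[OF fill map_g_tuples[OF that(1)]])
    \<comment> \<open>Index 1 survives if \<open>j = 0\<close>, and index 0 otherwise.\<close>
    show "- {j} \<inter> {0..r + 1} \<noteq> {}" by (cases j) force+
  qed (use that in auto)
  have CM1': "(\<Inter>j\<in>{0..r + 1}. Y.nhood (\<mu>' \<delta>\<^sub>1) (push F (nths ys (- {j})))) \<noteq> {}"
    if ys: "ys \<in> Y.tuples (r + 2)" for ys
  proof -
    \<comment> \<open>At \<open>\<delta>\<^sub>0\<close> the affine function takes the value
      \<open>b\<close>.\<close>
    obtain x where x: "x \<in> (\<Inter>j\<in>{0..r + 1}. X.nhood b (F (nths (map g ys) (- {j}))))"
      using CM1 map_g_tuples[OF ys] \<mu> by fastforce
    have "f x \<in> Y.nhood (\<mu>' \<delta>\<^sub>1) (push F (nths ys (- {j})))" if j: "j \<in> {0..r + 1}" for j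
      unfolding push_def nths_map[symmetric]
      using x j b by (intro nhood_image[OF _ S[OF ys j], where s = b]) (auto simp: \<mu>'_def b'_def)
    then show ?thesis by blast
  qed
  have CM2': "Y.diam (\<Inter>j\<in>{0..r + 1}. Y.nhood (\<mu>' \<delta>) (push F (nths ys (- {j})))) \<le> ennreal (\<Psi>' \<delta> D)"
    if \<delta>: "\<delta>\<^sub>1 \<le> \<delta>" and D: "\<delta>\<^sub>1 \<le> D" and ys: "ys \<in> Y.tuples (r + 2)"
      and gen: "Y.generic r (push F) \<delta> D ys" for \<delta> D ys
  proof -
    let ?A = "\<Inter>j\<in>{0..r + 1}. X.nhood (\<mu> (\<rho> \<delta>)) (F (nths (map g ys) (- {j})))"
    let ?B = "\<Inter>j\<in>{0..r + 1}. Y.nhood (\<mu>' \<delta>) (push F (nths ys (- {j})))"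
    have \<Psi>p: "0 \<le> \<Psi> (\<rho> \<delta>) (K * (D + L))" using \<Psi>0 \<rho>_ge[OF \<delta>] D_ge[OF D] by blast
    have "X.generic r F (\<rho> \<delta>) (K * (D + L)) (map g ys)"
      using \<rho>_ge[OF \<delta>] \<delta>0 \<delta>01 D \<rho>_less by (intro generic_map_g[OF fill ys gen]) auto
    then have "X.diam ?A \<le> ennreal (\<Psi> (\<rho> \<delta>) (K * (D + L)))"
      using CM2 \<rho>_ge[OF \<delta>] D_ge[OF D] map_g_tuples[OF ys] by blast
    note A = this[unfolded X.diam_le_iff[OF \<Psi>p], rule_format]
    \<comment> \<open>\<open>g\<close> maps \<open>?B\<close> into \<open>?A\<close>, whose diameter
      (CM2) in \<open>X\<close> bounds; \<open>g_lower_le\<close> turns this into a bound for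
      \<open>?B\<close>.\<close>
    have B: "g y \<in> ?A" "y \<in> Y" if y: "y \<in> ?B" for y
    proof -
      have yj: "y \<in> Y.nhood (\<mu>' \<delta>) (f ` F (nths (map g ys) (- {j})))" if "j \<in> {0..r + 1}" for j
        using y that by (auto simp: push_def nths_map)
      show "g y \<in> ?A"
        by (intro INT_I nhood_preimage[OF yj S[OF ys] \<mu>_ge0[OF \<delta>] \<mu>_less[OF \<delta>]])
      have 0: "0 \<in> {0..r + 1}" by simp
      have "f ` F (nths (map g ys) (- {0})) \<subseteq> Y" using S[OF ys 0] f by auto
      then show "y \<in> Y" using Y.nhoodE[OF yj[OF 0] _ \<mu>_ge0[OF \<delta>]] by blast
    qed
    have "dY y y' \<le> \<Psi>' \<delta> D" if "y \<in> ?B" "y' \<in> ?B" for y y'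
      unfolding \<Psi>'_def by (rule g_lower_le[OF B(2) B(2) A[OF B(1) B(1)]]) (fact that)+
    moreover have "0 \<le> \<Psi>' \<delta> D" using \<Psi>p K L by (simp add: \<Psi>'_def)
    ultimately show ?thesis using Y.diam_le_iff by blast
  qed
  have \<Psi>0': "0 \<le> \<Psi>' \<delta> D" if "\<delta>\<^sub>1 \<le> \<delta>" "\<delta>\<^sub>1 \<le> D" for \<delta> D
    using \<Psi>0 \<rho>_ge[OF that(1)] D_ge[OF that(2)] K L by (simp add: \<Psi>'_def)
  have \<Psi>1': "mono_on {\<delta>\<^sub>1..} (\<lambda>D. \<Psi>' \<delta> D)" if "\<delta>\<^sub>1 \<le> \<delta>" for \<delta>
  proof (rule mono_onI)
    fix D D' assume "D \<in> {\<delta>\<^sub>1..}" "D' \<in> {\<delta>\<^sub>1..}" "D \<le> D'"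
    then have "\<Psi> (\<rho> \<delta>) (K * (D + L)) \<le> \<Psi> (\<rho> \<delta>) (K * (D' + L))"
      using D_ge D_mono by (intro mono_onD[OF \<Psi>1[rule_format, OF \<rho>_ge[OF that]]]) auto
    then show "\<Psi>' \<delta> D \<le> \<Psi>' \<delta> D'" using K by (simp add: \<Psi>'_def)
  qed
  have \<Psi>2': "mono_on {\<delta>\<^sub>1..} (\<lambda>\<delta>. \<Psi>' \<delta> D)" if "\<delta>\<^sub>1 \<le> D" for D
  proof (rule mono_onI)
    fix \<delta> \<delta>' assume "\<delta> \<in> {\<delta>\<^sub>1..}" "\<delta>' \<in> {\<delta>\<^sub>1..}" "\<delta> \<le> \<delta>'"
    then have "\<Psi> (\<rho> \<delta>) (K * (D + L)) \<le> \<Psi> (\<rho> \<delta>') (K * (D + L))"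
      using \<rho>_ge \<rho>_mono by (intro mono_onD[OF \<Psi>2[rule_format, OF D_ge[OF that]]]) auto
    then show "\<Psi>' \<delta> D \<le> \<Psi>' \<delta>' D" using K by (simp add: \<Psi>'_def)
  qed
  show ?thesis
    unfolding Y.has_coarse_median_structure_def
  proof (intro exI conjI)
    show "Y.coarse_filling r (push F) (push_bound \<Lambda>)" by (rule coarse_filling_push[OF fill])
    show "\<delta>\<^sub>1 \<ge> 0" using \<delta>0 \<delta>01 by simp
    show "a / K\<^sup>2 > 0" using a K by simp
    show "\<forall>\<delta>\<ge>\<delta>\<^sub>1. \<mu>' \<delta> = a / K\<^sup>2 * (\<delta> - \<delta>\<^sub>1) + b'" by (simp add: \<mu>'_def)
    show "\<forall>\<delta>\<ge>\<delta>\<^sub>1. \<forall>D\<ge>\<delta>\<^sub>1. 0 \<le> \<Psi>' \<delta> D" using \<Psi>0' by blast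
  qed (use b' \<Psi>1' \<Psi>2' CM1' CM2' in blast)+
qed

end

section \<open>Existence of a coarse inverse\<close>

lemma quasi_isometry_coarse_inverse:
  assumes "Metric_space X dX" "Metric_space Y dY" "quasi_isometry K L X dX Y dY f"
  obtains g where "coarse_inverse_pair X dX Y dY f g K L"
proof -
  interpret X: Metric_space X dX by fact
  interpret Y: Metric_space Y dY by fact
  have K: "1 \<le> K" and L: "0 \<le> L" and f: "f \<in> X \<rightarrow> Y"
    and lower: "\<And>x x'. x \<in> X \<Longrightarrow> x' \<in> X \<Longrightarrow> 1 / K * dX x x' - L \<le> dY (f x) (f x')"
    and upper: "\<And>x x'. x \<in> X \<Longrightarrow> x' \<in> X \<Longrightarrow> dY (f x) (f x') \<le> K * dX x x' + L"
    and dense: "Y \<subseteq> Y.nhood L (f ` X)"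
    using assms(3) unfolding quasi_isometry_def by auto
  have "\<exists>x\<in>X. dY y (f x) \<le> L" if "y \<in> Y" for y
  proof -
    have "y \<in> Y.nhood L (f ` X)" "f ` X \<subseteq> Y" using dense that f by auto
    then show ?thesis using Y.nhoodE[OF _ _ L] by blast
  qed
  then obtain g where "\<And>y. y \<in> Y \<Longrightarrow> g y \<in> X \<and> dY y (f (g y)) \<le> L" by metis
  moreover have "dX x x' \<le> K * (dY (f x) (f x') + L)" if "x \<in> X" "x' \<in> X" for x x'
    using lower[OF that] K by (simp add: field_simps)
  ultimately have "coarse_inverse_pair X dX Y dY f g K L"
    using K L f upper by unfold_locales auto
  then show thesis by (rule that)
qed

theorem proposition8p13:
  fixes X :: "'a set" and dX :: "'a \<Rightarrow> 'a \<Rightarrow> real"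
    and Y :: "'b set" and dY :: "'b \<Rightarrow> 'b \<Rightarrow> real"
    and f :: "'a \<Rightarrow> 'b" and K L :: real and r :: nat
  assumes "Metric_space X dX" and "Metric_space Y dY"
    and "quasi_isometry K L X dX Y dY f"
    and "r \<ge> 1"
    and "Metric_space.has_coarse_median_structure X dX r"
  shows "Metric_space.has_coarse_median_structure Y dY r"
proof -
  obtain g where "coarse_inverse_pair X dX Y dY f g K L"
    using quasi_isometry_coarse_inverse assms(1-3) by blast
  then show ?thesis
    using assms(5) by (rule coarse_inverse_pair.has_coarse_median_structure_push)
qed

end
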